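(* An asymmetric $3$-quasi-transitive digraph is a KP-digraph if and only if it has no induced subdigraph isomorphic to $\overrightarrow{C}_3$. An asymmetric digraph that is arc-locally in-semicomplete, or arc-locally out-semicomplete, or $3$-anti-quasi-transitive and $TT_3$-free, is a KP-digraph if and only if it has no induced subdigraph that is a directed cycle of odd length.
   Context: Digraphs are finite, without loops or parallel arcs. $D$ is asymmetric if there are no two vertices $u,v$ with both $uv,vu\in A(D)$. A kernel is a set $S$ of vertices that is independent (no arc between two vertices of $S$) and absorbent (every vertex outside $S$ has an arc into $S$). $D$ is a KP-digraph if $D$ and every induced subdigraph of $D$ have a kernel. Consider paths $uvwx$ on four distinct vertices (not necessarily directed). $D$ is arc-locally in-semicomplete if for every such path with arcs $uv,wv,xw$ the vertices $u,x$ are adjacent; arc-locally out-semicomplete if for every such path with arcs $vu,wv,wx$ the vertices $u,x$ are adjacent; $3$-quasi-transitive if for every directed path $uvwx$ the vertices $u,x$ are adjacent; $3$-anti-quasi-transitive if for every anti-directed path $uvwx$ (no directed subpath of length $2$) the vertices $u,x$ are adjacent. $TT_3$ is the transitive tournament on $3$ vertices; $TT_3$-free means no induced subdigraph isomorphic to $TT_3$. $\overrightarrow{C}_3$ is the directed $3$-cycle. *)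

theory Defs
  imports "Graph_Theory.Graph_Theory"
begin

text \<open>
  The locale \<^locale>\<open>digraph\<close> (finite, no loops, no parallel arcs) admits the digraph
  without vertices. This is harmless for kernels: it has the empty set as its kernel.
\<close>

definition asymmetric :: "('a,'b) pre_digraph \<Rightarrow> bool" where
  "asymmetric D \<longleftrightarrow> (\<nexists>u v. u \<rightarrow>\<^bsub>D\<^esub> v \<and> v \<rightarrow>\<^bsub>D\<^esub> u)"

definition adjacent :: "('a,'b) pre_digraph \<Rightarrow> 'a \<Rightarrow> 'a \<Rightarrow> bool" where
  "adjacent D u v \<longleftrightarrow> u \<rightarrow>\<^bsub>D\<^esub> v \<or> v \<rightarrow>\<^bsub>D\<^esub> u"


definition independent_set :: "('a,'b) pre_digraph \<Rightarrow> 'a set \<Rightarrow> bool" where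
  "independent_set D S \<longleftrightarrow> (\<forall>u\<in>S. \<forall>v\<in>S. \<not> u \<rightarrow>\<^bsub>D\<^esub> v)"

definition absorbent_set :: "('a,'b) pre_digraph \<Rightarrow> 'a set \<Rightarrow> bool" where
  "absorbent_set D S \<longleftrightarrow> (\<forall>u \<in> verts D - S. \<exists>v\<in>S. u \<rightarrow>\<^bsub>D\<^esub> v)"

definition kernel :: "('a,'b) pre_digraph \<Rightarrow> 'a set \<Rightarrow> bool" where
  "kernel D S \<longleftrightarrow> S \<subseteq> verts D \<and> independent_set D S \<and> absorbent_set D S"

definition KP_digraph :: "('a,'b) pre_digraph \<Rightarrow> bool" where
  "KP_digraph D \<longleftrightarrow>
     (\<exists>S. kernel D S) \<and> (\<forall>H. induced_subgraph H D \<longrightarrow> (\<exists>S. kernel H S))"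


definition arc_locally_in_semicomplete :: "('a,'b) pre_digraph \<Rightarrow> bool" where
  "arc_locally_in_semicomplete D \<longleftrightarrow>
     (\<forall>u v w x. distinct [u, v, w, x] \<and> u \<rightarrow>\<^bsub>D\<^esub> v \<and> w \<rightarrow>\<^bsub>D\<^esub> v \<and> x \<rightarrow>\<^bsub>D\<^esub> w
        \<longrightarrow> adjacent D u x)"

definition arc_locally_out_semicomplete :: "('a,'b) pre_digraph \<Rightarrow> bool" where
  "arc_locally_out_semicomplete D \<longleftrightarrow>
     (\<forall>u v w x. distinct [u, v, w, x] \<and> v \<rightarrow>\<^bsub>D\<^esub> u \<and> w \<rightarrow>\<^bsub>D\<^esub> v \<and> w \<rightarrow>\<^bsub>D\<^esub> x
        \<longrightarrow> adjacent D u x)"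

definition three_quasi_transitive :: "('a,'b) pre_digraph \<Rightarrow> bool" where
  "three_quasi_transitive D \<longleftrightarrow>
     (\<forall>u v w x. distinct [u, v, w, x] \<and> u \<rightarrow>\<^bsub>D\<^esub> v \<and> v \<rightarrow>\<^bsub>D\<^esub> w \<and> w \<rightarrow>\<^bsub>D\<^esub> x
        \<longrightarrow> adjacent D u x)"

text \<open>
  A path on four vertices has no directed subpath of length two exactly if its three arcs
  alternate in direction; the disjunction lists the two alternating patterns.
\<close>
definition three_anti_quasi_transitive :: "('a,'b) pre_digraph \<Rightarrow> bool" where
  "three_anti_quasi_transitive D \<longleftrightarrow>
     (\<forall>u v w x. distinct [u, v, w, x] \<and>
        (u \<rightarrow>\<^bsub>D\<^esub> v \<and> w \<rightarrow>\<^bsub>D\<^esub> v \<and> w \<rightarrow>\<^bsub>D\<^esub> x \<or> v \<rightarrow>\<^bsub>D\<^esub> u \<and> v \<rightarrow>\<^bsub>D\<^esub> w \<and> x \<rightarrow>\<^bsub>D\<^esub> w)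
        \<longrightarrow> adjacent D u x)"


definition has_induced_copy :: "('a,'b) pre_digraph \<Rightarrow> ('c,'d) pre_digraph \<Rightarrow> bool" where
  "has_induced_copy D F \<longleftrightarrow> (\<exists>H. induced_subgraph H D \<and> digraph_iso H F)"

definition TT3 :: "nat pair_pre_digraph" where
  "TT3 = \<lparr> pverts = {0, 1, 2}, parcs = {(0, 1), (1, 2), (0, 2)} \<rparr>"

definition TT3_free :: "('a,'b) pre_digraph \<Rightarrow> bool" where
  "TT3_free D \<longleftrightarrow> \<not> has_induced_copy D (with_proj TT3)"

text \<open>
  Intended for \<open>n \<ge> 2\<close>: for \<open>n = 1\<close> the definition yields a loop, for \<open>n = 0\<close> no vertices.
\<close>
definition directed_cycle :: "nat \<Rightarrow> nat pair_pre_digraph" where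
  "directed_cycle n = \<lparr> pverts = {..<n}, parcs = {(i, Suc i mod n) | i. i < n} \<rparr>"

end

theory Submission
  imports Defs
begin

text \<open>
  A finite digraph without odd closed walks has a kernel (Richardson), and so does each of its
  induced subdigraphs. In each of the four classes an odd closed walk leads to a forbidden induced
  cycle: take a shortest one \<open>v\<^sub>0, \<dots>, v\<^bsub>n-1\<^esub>\<close>. By minimality a chord that jumps forward by
  \<open>k \<le> n - 2\<close> has \<open>k\<close> even, so the parity of the distance fixes the direction of every arc
  between two vertices of the walk. An adjacency condition applied to a chord with \<open>k \<ge> 4\<close> yields one
  with jump \<open>k - 2\<close>, hence eventually one with jump \<open>2\<close>. This is a transitive triangle; in the
  arc-locally semicomplete classes it can be shifted along the walk until two jumps compose to a
  shorter odd closed walk. In a 3-quasi-transitive digraph with \<open>n \<ge> 5\<close>, the arcs from \<open>v\<^bsub>i+3\<^esub>\<close> to \<open>v\<^sub>i\<close>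
  produce arcs from \<open>v\<^bsub>i+n-2\<^esub>\<close> to \<open>v\<^sub>i\<close>, and both kinds together close a directed triangle.
\<close>

section \<open>Kernels and odd closed walks\<close>

lemma relpow_mono: "R \<subseteq> S \<Longrightarrow> R ^^ n \<subseteq> S ^^ n" for R S :: "'a rel"
  by (induction n) (auto intro: relcomp_mono)

text \<open>
  The vertices reachable by an even walk from a vertex \<open>r\<close> of a terminal strong component form an
  independent set \<open>X\<close>, since an arc inside \<open>X\<close> would close an odd walk. Every out-neighbour of \<open>X\<close> has
  an arc back into \<open>X\<close>, so \<open>X\<close> can be completed by a kernel of the vertices neither in \<open>X\<close> nor
  absorbed by it.
\<close>
lemma kernel_if_no_odd_closed_walk_rel:
  assumes "finite V" and no_odd: "\<And>n x. odd n \<Longrightarrow> (x, x) \<notin> R ^^ n"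
  shows "\<exists>S\<subseteq>V. (\<forall>u\<in>S. \<forall>v\<in>S. (u, v) \<notin> R) \<and> (\<forall>u\<in>V - S. \<exists>v\<in>S. (u, v) \<in> R)"
  using assms(1)
proof (induction V rule: finite_psubset_induct)
  case (psubset V)
  show ?case
  proof (cases "V = {}")
    case False
    \<comment> \<open>The induction descends to subsets of \<open>V\<close>, so walks have to stay
      inside the current \<open>V\<close>.\<close>
    define Q where "Q = R \<inter> V \<times> V"
    define reach where "reach u = {v \<in> V. (u, v) \<in> Q\<^sup>*}" for u
    have no_odd_Q: "(x, x) \<notin> Q ^^ n" if "odd n" for x n
      using no_odd[OF that] relpow_mono[of Q R n] by (auto simp: Q_def)
    \<comment> \<open>A smallest reachable set puts \<open>r\<close> in a terminal strong component:
      every vertex that \<open>r\<close> reaches has the same reachable set, hence reaches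
      \<open>r\<close>.\<close>
    obtain r where r: "r \<in> V" and r_min: "\<And>u. u \<in> V \<Longrightarrow> card (reach r) \<le> card (reach u)"
      using False ex_has_least_nat[of "\<lambda>u. u \<in> V" _ "\<lambda>u. card (reach u)"] by blast
    have returns: "(u, r) \<in> Q\<^sup>*" if "(r, u) \<in> Q\<^sup>*" for u
    proof -
      have "u \<in> V" using that r by induction (auto simp: Q_def)
      have "reach u \<subseteq> reach r" using that by (auto simp: reach_def)
      moreover have "finite (reach r)" using psubset.hyps by (simp add: reach_def)
      ultimately have "reach u = reach r"
        using r_min[OF \<open>u \<in> V\<close>] by (simp add: card_seteq)
      then show ?thesis using r by (auto simp: reach_def)
    qed
    define X where "X = {v. \<exists>n. even n \<and> (r, v) \<in> Q ^^ n}"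
    have "r \<in> X" unfolding X_def using relpow_0_I[of r Q] even_zero by blast
    have X_V: "X \<subseteq> V"
    proof
      fix x assume "x \<in> X"
      then have "(r, x) \<in> Q\<^sup>*" by (auto simp: X_def relpow_imp_rtrancl)
      then show "x \<in> V" using r by induction (auto simp: Q_def)
    qed
    have X_indep: "(x, y) \<notin> R" if xy_X: "x \<in> X" "y \<in> X" for x y
    proof
      assume "(x, y) \<in> R"
      obtain m where m: "even m" "(r, x) \<in> Q ^^ m" using xy_X by (auto simp: X_def)
      obtain k where k: "even k" "(r, y) \<in> Q ^^ k" using xy_X by (auto simp: X_def)
      obtain p where p: "(y, r) \<in> Q ^^ p"
        using returns[of y] k relpow_imp_rtrancl rtrancl_imp_relpow by metis
      have xy: "(x, y) \<in> Q" using \<open>(x, y) \<in> R\<close> xy_X X_V by (auto simp: Q_def)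
      \<comment> \<open>The even walk to \<open>y\<close> and the odd walk to \<open>y\<close>
        through \<open>x\<close> share the return walk, so one of the two closed walks is
        odd.\<close>
      have "(r, r) \<in> Q ^^ (k + p)" using k(2) p by (rule relpow_trans)
      moreover have "(r, r) \<in> Q ^^ (Suc m + p)"
        using relpow_Suc_I[OF m(2) xy] p by (rule relpow_trans)
      ultimately show False using no_odd_Q k(1) m(1) by (metis even_Suc even_add)
    qed
    have X_back: "\<exists>y\<in>X. (z, y) \<in> R" if xz: "x \<in> X" "z \<in> V" "(x, z) \<in> R" for x z
    proof -
      obtain m where m: "even m" "(r, x) \<in> Q ^^ m" using xz by (auto simp: X_def)
      have "(x, z) \<in> Q" using xz X_V by (auto simp: Q_def)
      with m have z: "(r, z) \<in> Q ^^ Suc m" by (blast intro: relpow_Suc_I)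
      \<comment> \<open>The return walk from \<open>z\<close> to \<open>r\<close> is thus nonempty,
        and its first vertex \<open>y\<close> is at even distance along a walk from
        \<open>r\<close>.\<close>
      have "z \<noteq> r" using z no_odd_Q m(1) by (metis even_Suc)
      moreover have "(z, r) \<in> Q\<^sup>*" using z by (blast intro: returns relpow_imp_rtrancl)
      ultimately obtain y where "(z, y) \<in> Q" by (meson converse_rtranclE)
      then have "(r, y) \<in> Q ^^ Suc (Suc m)" using z by (blast intro: relpow_Suc_I)
      moreover have "even (Suc (Suc m))" using m(1) by simp
      ultimately have "y \<in> X" unfolding X_def by blast
      then show ?thesis using \<open>(z, y) \<in> Q\<close> by (auto simp: Q_def)
    qed
    define W where "W = V - X - {u. \<exists>x\<in>X. (u, x) \<in> R}"
    have "W \<subset> V" using r \<open>r \<in> X\<close> by (auto simp: W_def)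
    from psubset.IH[OF this] obtain K where K: "K \<subseteq> W"
      "\<forall>u\<in>K. \<forall>v\<in>K. (u, v) \<notin> R" "\<forall>u\<in>W - K. \<exists>v\<in>K. (u, v) \<in> R" by blast
    \<comment> \<open>An arc from \<open>X\<close> to \<open>k\<close> would come with an arc from
      \<open>k\<close> back into \<open>X\<close>, which the choice of \<open>W\<close>
      forbids.\<close>
    have "(x, k) \<notin> R" "(k, x) \<notin> R" if "x \<in> X" "k \<in> K" for x k
      using that X_back[of x k] K(1) by (auto simp: W_def)
    then have "\<forall>u\<in>X \<union> K. \<forall>v\<in>X \<union> K. (u, v) \<notin> R"
      using X_indep K(2) by blast
    moreover have "\<forall>u\<in>V - (X \<union> K). \<exists>v\<in>X \<union> K. (u, v) \<in> R"
      using K(3) by (auto simp: W_def)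
    ultimately show ?thesis using X_V K(1) \<open>W \<subset> V\<close> by (intro exI[of _ "X \<union> K"]) auto
  qed auto
qed

lemma (in fin_digraph) KP_digraph_if_no_odd_closed_walk:
  assumes no_odd: "\<And>n x. odd n \<Longrightarrow> (x, x) \<notin> arcs_ends G ^^ n"
  shows "KP_digraph G"
proof -
  have "\<exists>S. kernel H S" if H: "induced_subgraph H G" for H
  proof -
    have "arcs_ends H \<subseteq> arcs_ends G" "finite (verts H)"
      using H by (auto simp: induced_subgraph_def subgraph_def compatible_def arcs_ends_conv
          intro: finite_subset)
    then have "(x, x) \<notin> arcs_ends H ^^ n" if "odd n" for n x
      using no_odd[OF that] relpow_mono[of "arcs_ends H" "arcs_ends G" n] by auto
    with \<open>finite (verts H)\<close> show ?thesis
      using kernel_if_no_odd_closed_walk_rel[of "verts H" "arcs_ends H"]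
      by (simp add: kernel_def independent_set_def absorbent_set_def)
  qed
  then show ?thesis using induced_subgraph_refl by (auto simp: KP_digraph_def)
qed

section \<open>Induced copies\<close>

text \<open>The isomorphism inverts \<open>g\<close> on vertices and sends an arc to the pair of its
  mapped ends; this is injective because there are no parallel arcs.\<close>

lemma (in digraph) has_induced_copy_with_projI:
  fixes F :: "'c pair_pre_digraph"
  assumes F: "pair_wf_digraph F"
    and inj: "inj_on g (pverts F)" and g_verts: "g ` pverts F \<subseteq> verts G"
    and g_arcs: "\<And>i j. i \<in> pverts F \<Longrightarrow> j \<in> pverts F \<Longrightarrow> g i \<rightarrow>\<^bsub>G\<^esub> g j \<longleftrightarrow> (i, j) \<in> parcs F"
  shows "has_induced_copy G (with_proj F)"
proof -
  interpret F: pair_wf_digraph F by fact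
  let ?H = "G \<restriction> (g ` pverts F)"
  define h where "h = the_inv_into (pverts F) g"
  have h: "h (g i) = i" if "i \<in> pverts F" for i
    using that inj by (simp add: h_def the_inv_into_f_f)
  define iso where "iso = \<lparr>iso_verts = h, iso_arcs = (\<lambda>e. (h (tail G e), h (head G e))),
    iso_head = snd, iso_tail = fst\<rparr>"
  have ind: "induced_subgraph ?H G" using g_verts by (rule induced_induce)
  have "pre_digraph.digraph_isomorphism ?H iso"
    unfolding pre_digraph.digraph_isomorphism_def
  proof (intro conjI)
    show "wf_digraph ?H" by (rule wellformed_induce_subgraph)
    show "inj_on (iso_verts iso) (verts ?H)" by (auto simp: iso_def h intro!: inj_onI)
    show "inj_on (iso_arcs iso) (arcs ?H)"
    proof (rule inj_onI)
      fix e f assume ef: "e \<in> arcs ?H" "f \<in> arcs ?H" and eq: "iso_arcs iso e = iso_arcs iso f"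
      obtain a b c d where "tail G e = g a" "head G e = g b" "tail G f = g c" "head G f = g d"
        "a \<in> pverts F" "b \<in> pverts F" "c \<in> pverts F" "d \<in> pverts F"
        using ef by auto
      then have "arc_to_ends G e = arc_to_ends G f"
        using eq by (simp add: iso_def h arc_to_ends_def)
      then show "e = f" using ef no_multi_arcs by auto
    qed
  qed (auto simp: iso_def)
  moreover have "with_proj F = app_iso iso ?H"
  proof (rule pre_digraph.equality)
    show "verts (with_proj F) = verts (app_iso iso ?H)"
      by (simp add: iso_def image_image h)
    show "arcs (with_proj F) = arcs (app_iso iso ?H)"
    proof (intro set_eqI iffI)
      fix p assume p: "p \<in> arcs (with_proj F)"
      obtain i j where ij: "p = (i, j)" "i \<in> pverts F" "j \<in> pverts F"
        using p F.wellformed' by (cases p) auto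
      then have "g i \<rightarrow>\<^bsub>G\<^esub> g j" using p g_arcs by simp
      then obtain e where "e \<in> arcs G" "tail G e = g i" "head G e = g j" by blast
      then show "p \<in> arcs (app_iso iso ?H)"
        using ij by (auto simp: iso_def h intro!: image_eqI[of _ _ e])
    next
      fix p assume "p \<in> arcs (app_iso iso ?H)"
      then obtain e i j where e: "e \<in> arcs G" "tail G e = g i" "head G e = g j"
        and ij: "i \<in> pverts F" "j \<in> pverts F" and "p = (h (tail G e), h (head G e))"
        by (auto simp: iso_def)
      moreover have "g i \<rightarrow>\<^bsub>G\<^esub> g j" using e dominatesI[of e] by (simp add: arc_to_ends_def)
      ultimately show "p \<in> arcs (with_proj F)" using g_arcs[OF ij] by (simp add: h)
    qed
  qed (simp_all add: iso_def)
  ultimately show ?thesis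
    unfolding has_induced_copy_def digraph_iso_def using ind by blast
qed

text \<open>In \<open>with_proj F\<close> an arc is the pair of its ends, so the vertex map of the
  isomorphism already determines the arc map.\<close>

lemma has_induced_copy_with_projE:
  fixes F :: "'c pair_pre_digraph"
  assumes "has_induced_copy D (with_proj F)"
  obtains H g where "induced_subgraph H D" "bij_betw g (pverts F) (verts H)"
    "\<And>i j. i \<in> pverts F \<Longrightarrow> j \<in> pverts F \<Longrightarrow> g i \<rightarrow>\<^bsub>H\<^esub> g j \<longleftrightarrow> (i, j) \<in> parcs F"
proof -
  obtain H f where H: "induced_subgraph H D" and f: "pre_digraph.digraph_isomorphism H f"
    and app: "with_proj F = app_iso f H"
    using assms by (auto simp: has_induced_copy_def digraph_iso_def)
  let ?h = "iso_verts f" and ?g = "the_inv_into (verts H) (iso_verts f)"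
  have inj: "inj_on ?h (verts H)" and wf: "wf_digraph H"
    and ends: "\<And>e. e \<in> arcs H \<Longrightarrow> ?h (tail H e) = iso_tail f (iso_arcs f e)"
      "\<And>e. e \<in> arcs H \<Longrightarrow> ?h (head H e) = iso_head f (iso_arcs f e)"
    using f by (auto simp: pre_digraph.digraph_isomorphism_def)
  have "verts (with_proj F) = ?h ` verts H" unfolding app by simp
  then have verts: "pverts F = ?h ` verts H" by simp
  have "tail (with_proj F) = iso_tail f" "head (with_proj F) = iso_head f"
    "arcs (with_proj F) = iso_arcs f ` arcs H" unfolding app by simp_all
  then have "iso_arcs f e = (?h (tail H e), ?h (head H e))" if "e \<in> arcs H" for e
    using ends[OF that] by (simp add: prod_eq_iff)
  then have arcs: "parcs F = (\<lambda>e. (?h (tail H e), ?h (head H e))) ` arcs H"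
    using \<open>arcs (with_proj F) = iso_arcs f ` arcs H\<close> by auto
  have h: "?h x \<in> pverts F" "?g (?h x) = x" if "x \<in> verts H" for x
    using that verts inj by (auto simp: the_inv_into_f_f)
  have bij: "bij_betw ?g (pverts F) (verts H)"
    using bij_betw_the_inv_into[of ?h "verts H" "pverts F"] inj verts by (simp add: bij_betw_def)
  have "?g i \<rightarrow>\<^bsub>H\<^esub> ?g j \<longleftrightarrow> (i, j) \<in> parcs F" if ij: "i \<in> pverts F" "j \<in> pverts F" for i j
  proof -
    obtain x y where xy: "i = ?h x" "j = ?h y" "x \<in> verts H" "y \<in> verts H"
      using ij verts by auto
    show ?thesis
      using xy h inj wf_digraph.tail_in_verts[OF wf] wf_digraph.head_in_verts[OF wf]
      by (auto simp: arcs arcs_ends_conv image_iff inj_on_eq_iff)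
  qed
  with H bij show ?thesis by (rule that)
qed

lemma pair_wf_digraph_directed_cycle: "pair_wf_digraph (directed_cycle n)"
  by unfold_locales (auto simp: directed_cycle_def)

text \<open>Along an odd cycle, membership in a kernel would have to alternate.\<close>
lemma not_KP_digraph_if_odd_cycle:
  assumes copy: "has_induced_copy D (with_proj (directed_cycle n))" and "odd n"
  shows "\<not> KP_digraph D"
proof
  assume KP: "KP_digraph D"
  obtain H g where H: "induced_subgraph H D" and bij: "bij_betw g {..<n} (verts H)"
    and g_arcs: "\<And>i j. i < n \<Longrightarrow> j < n \<Longrightarrow> g i \<rightarrow>\<^bsub>H\<^esub> g j \<longleftrightarrow> j = Suc i mod n"
    using copy by (rule has_induced_copy_with_projE) (auto simp: directed_cycle_def)
  obtain S where S: "kernel H S" using KP H by (auto simp: KP_digraph_def)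
  have "n > 0" using \<open>odd n\<close> by (cases n) auto
  define P where "P i \<longleftrightarrow> g (i mod n) \<in> S" for i
  have in_verts: "g (i mod n) \<in> verts H" for i
    using bij \<open>n > 0\<close> by (auto simp: bij_betw_def)
  have arc: "g (i mod n) \<rightarrow>\<^bsub>H\<^esub> g j \<longleftrightarrow> j = Suc i mod n" if "j < n" for i j
    using g_arcs[of "i mod n" j] that \<open>n > 0\<close> by (simp add: mod_Suc_eq)
  have alt: "P (Suc i) \<longleftrightarrow> \<not> P i" for i
  proof
    assume "P (Suc i)"
    moreover have "g (i mod n) \<rightarrow>\<^bsub>H\<^esub> g (Suc i mod n)" using arc \<open>n > 0\<close> by simp
    ultimately show "\<not> P i" using S by (auto simp: P_def kernel_def independent_set_def)
  \<comment> \<open>The successor is the only out-neighbour on the cycle, so a vertex outside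
    \<open>S\<close> can only be absorbed there.\<close>
  next
    assume "\<not> P i"
    then obtain s where s: "s \<in> S" "g (i mod n) \<rightarrow>\<^bsub>H\<^esub> s"
      using S in_verts[of i] by (auto simp: P_def kernel_def absorbent_set_def)
    then obtain j where "j < n" "s = g j"
      using S bij by (auto simp: kernel_def bij_betw_def)
    then show "P (Suc i)" using s arc by (simp add: P_def)
  qed
  \<comment> \<open>At \<open>i = n\<close> the index wraps around to 0, although \<open>n\<close>
    alternations have flipped membership.\<close>
  have "P i \<longleftrightarrow> (P 0 \<longleftrightarrow> even i)" for i by (induction i) (auto simp: alt)
  from this[of n] show False using \<open>odd n\<close> by (simp add: P_def)
qed

text \<open>Asymmetry and the absence of loops exclude any further arc, so such a triple would
  induce exactly \<open>TT3\<close>.\<close>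

lemma (in digraph) no_transitive_triple_if_TT3_free:
  assumes "asymmetric G" "TT3_free G" "a \<rightarrow>\<^bsub>G\<^esub> b" "b \<rightarrow>\<^bsub>G\<^esub> c"
  shows "\<not> a \<rightarrow>\<^bsub>G\<^esub> c"
proof
  assume ac: "a \<rightarrow>\<^bsub>G\<^esub> c"
  let ?g = "\<lambda>i::nat. if i = 0 then a else if i = 1 then b else c"
  have asym: "\<not> y \<rightarrow>\<^bsub>G\<^esub> x" if "x \<rightarrow>\<^bsub>G\<^esub> y" for x y
    using assms(1) that by (auto simp: asymmetric_def)
  have distinct: "a \<noteq> b" "b \<noteq> c" "a \<noteq> c" using assms(3,4) ac adj_not_same by blast+
  have no_arcs: "\<not> b \<rightarrow>\<^bsub>G\<^esub> a" "\<not> c \<rightarrow>\<^bsub>G\<^esub> b" "\<not> c \<rightarrow>\<^bsub>G\<^esub> a" "\<not> x \<rightarrow>\<^bsub>G\<^esub> x" for x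
    using asym assms(3,4) ac by blast+
  have "has_induced_copy G (with_proj TT3)"
  proof (rule has_induced_copy_with_projI)
    show "pair_wf_digraph TT3" by unfold_locales (auto simp: TT3_def)
    show "inj_on ?g (pverts TT3)" using distinct by (simp add: TT3_def)
    show "?g ` pverts TT3 \<subseteq> verts G" using assms(3,4) by (auto simp: TT3_def dest: adj_in_verts)
    show "?g i \<rightarrow>\<^bsub>G\<^esub> ?g j \<longleftrightarrow> (i, j) \<in> parcs TT3" if "i \<in> pverts TT3" "j \<in> pverts TT3" for i j
      using that assms(3,4) ac no_arcs by (auto simp: TT3_def)
  qed
  then show False using assms(2) by (simp add: TT3_free_def)
qed

section \<open>Shortest odd closed walks\<close>

text \<open>
  The walk is stored as an \<open>n\<close>-periodic sequence, so that indices can be shifted freely.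
\<close>
locale shortest_odd_closed_walk =
  fixes R :: "'a rel" and n :: nat and v :: "nat \<Rightarrow> 'a"
  assumes asym: "(x, y) \<in> R \<Longrightarrow> (y, x) \<notin> R"
    and odd_length: "odd n"
    and step: "(v i, v (Suc i)) \<in> R"
    and periodic: "v (i + n) = v i"
    and shortest: "odd m \<Longrightarrow> m < n \<Longrightarrow> (x, x) \<notin> R ^^ m"

text \<open>Take the least odd length and repeat the walk periodically, reading indices modulo
  \<open>n\<close>.\<close>

lemma shortest_odd_closed_walk_exists:
  assumes asym: "\<And>x y. (x, y) \<in> R \<Longrightarrow> (y, x) \<notin> R" and "odd m" "(x, x) \<in> R ^^ m"
  obtains n v where "shortest_odd_closed_walk R n v"
proof -
  let ?P = "\<lambda>n. odd n \<and> (\<exists>y. (y, y) \<in> R ^^ n)"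
  define n where "n = (LEAST n. ?P n)"
  have "?P m" using assms(2,3) by blast
  then have "?P n" unfolding n_def by (rule LeastI)
  then obtain y where n: "odd n" "(y, y) \<in> R ^^ n" by blast
  obtain f where f: "f 0 = y" "f n = y" "\<And>i. i < n \<Longrightarrow> (f i, f (Suc i)) \<in> R"
    using n(2) by (auto simp: relpow_fun_conv)
  have "n > 0" using n(1) by (cases n) auto
  have "(f (i mod n), f (Suc i mod n)) \<in> R" for i
    using f(3)[of "i mod n"] f(1,2) \<open>n > 0\<close> by (auto simp: mod_Suc)
  moreover have "(x, x) \<notin> R ^^ k" if "odd k" "k < n" for x k
    using not_less_Least[of k ?P] that by (auto simp: n_def)
  ultimately have "shortest_odd_closed_walk R n (\<lambda>i. f (i mod n))"
    using asym n(1) by unfold_locales auto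
  then show ?thesis by (rule that)
qed

context shortest_odd_closed_walk
begin

lemma walk: "i \<le> j \<Longrightarrow> (v i, v j) \<in> R ^^ (j - i)"
proof (induction j rule: dec_induct)
  case (step j)
  then show ?case using shortest_odd_closed_walk.step[OF shortest_odd_closed_walk_axioms, of j]
    by (simp add: Suc_diff_le) blast
qed simp

lemma walk_around: "i \<le> j \<Longrightarrow> j \<le> i + n \<Longrightarrow> (v j, v i) \<in> R ^^ (i + n - j)"
  using walk[of j "i + n"] by (simp add: periodic)

text \<open>A repeated vertex splits the walk into two shorter closed walks; their lengths add up to
  the odd \<open>n\<close>, so one of them is odd.\<close>

lemma vertex_neq:
  assumes "i < j" "j < i + n"
  shows "v i \<noteq> v j" "v j \<noteq> v i"
proof -
  have "v i \<noteq> v j"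
  proof
    assume "v i = v j"
    then have "(v i, v i) \<in> R ^^ (j - i)" "(v i, v i) \<in> R ^^ (i + n - j)"
      using walk[of i j] walk_around[of i j] assms by auto
    moreover have "odd (j - i) \<or> odd (i + n - j)" using odd_length assms by auto
    ultimately show False using shortest assms
      by (metis add_diff_cancel_left' diff_less_mono less_diff_conv2 nat_less_le add_less_cancel_right)
  qed
  then show "v i \<noteq> v j" "v j \<noteq> v i" by auto
qed

text \<open>Following the chord and then the rest of the walk back to \<open>v i\<close> gives a
  shorter closed walk, odd if the jump is odd.\<close>

lemma forward_chord_even:
  assumes "(v i, v j) \<in> R" "i + 1 < j" "j \<le> i + n"
  shows "even (i + j)"
proof (rule ccontr)
  assume "odd (i + j)"
  have "(v i, v i) \<in> R ^^ Suc (i + n - j)"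
    by (rule relpow_Suc_I2[OF assms(1) walk_around]) (use assms in auto)
  moreover have "odd (Suc (i + n - j))" "Suc (i + n - j) < n"
    using \<open>odd (i + j)\<close> odd_length assms by auto
  ultimately show False using shortest by blast
qed

text \<open>The arc closes the stretch from \<open>v i\<close> to \<open>v j\<close> into a closed
  walk of length \<open>j - i + 1\<close>.\<close>

lemma backward_chord_odd:
  assumes "(v j, v i) \<in> R" "i \<le> j" "j + 1 < i + n"
  shows "odd (i + j)"
proof
  assume "even (i + j)"
  have "(v j, v j) \<in> R ^^ Suc (j - i)"
    by (rule relpow_Suc_I2[OF assms(1) walk]) (use assms in auto)
  moreover have "odd (Suc (j - i))" "Suc (j - i) < n"
    using \<open>even (i + j)\<close> assms by auto
  ultimately show False using shortest by blast
qed

lemma length_ge_3: "3 \<le> n"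
proof -
  have "n \<noteq> 1" using step[of 0] periodic[of 0] asym[of "v 0" "v 0"] by auto
  then show ?thesis using odd_length by presburger
qed

text \<open>The bound \<open>k + 3 \<le> n\<close> suffices: a jump of \<open>n - 2\<close> is odd,
  and a jump of \<open>n - 1\<close> reverses an arc of the walk.\<close>

lemma forward_chord_iff_if_chordless:
  assumes "\<And>i k. even k \<Longrightarrow> 2 \<le> k \<Longrightarrow> k + 3 \<le> n \<Longrightarrow> (v i, v (i + k)) \<notin> R" "a < n" "b < n"
  shows "(v a, v b) \<in> R \<longleftrightarrow> b = Suc a mod n"
proof
  assume "b = Suc a mod n"
  then have "v b = v (Suc a)"
    using \<open>a < n\<close> periodic[of 0] by (cases "Suc a = n") auto
  then show "(v a, v b) \<in> R" using step by simp
next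
  assume ab: "(v a, v b) \<in> R"
  have "a \<noteq> b" using ab asym by blast
  \<comment> \<open>The cyclic distance from \<open>a\<close> forward to \<open>b\<close>.\<close>
  define k where "k = (if a < b then b - a else b + n - a)"
  have vb: "v b = v (a + k)" and k: "0 < k" "k < n"
    using \<open>a \<noteq> b\<close> assms(2,3) periodic[of b] by (auto simp: k_def)
  have "k = 1"
  proof (rule ccontr)
    assume "k \<noteq> 1"
    then have "even k" using forward_chord_even[of a "a + k"] ab vb k by auto
    moreover have "k \<noteq> n - 1"
    proof
      assume "k = n - 1"
      then have "v (Suc (a + k)) = v a" using periodic[of a] k
        by (metis Suc_diff_1 add_Suc_right less_nat_zero_code neq0_conv)
      then show False using step[of "a + k"] ab vb asym by auto
    qed
    moreover have "k \<noteq> n - 2" using \<open>even k\<close> odd_length length_ge_3 by auto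
    ultimately show False using assms(1)[of k a] ab vb k \<open>k \<noteq> 1\<close> by auto
  qed
  then show "b = Suc a mod n" using assms(2,3) by (auto simp: k_def mod_Suc split: if_splits)
qed

lemma forward_if_even:
  assumes "(v i, v j) \<in> R \<or> (v j, v i) \<in> R" "even (i + j)" "i \<le> j" "j + 1 < i + n"
  shows "(v i, v j) \<in> R"
  using assms backward_chord_odd by blast

lemma backward_if_odd:
  assumes "(v i, v j) \<in> R \<or> (v j, v i) \<in> R" "odd (i + j)" "i + 1 < j" "j \<le> i + n"
  shows "(v j, v i) \<in> R"
  using assms forward_chord_even by blast

text \<open>Two shortcuts in place of four steps leave an odd closed walk of length
  \<open>n - 2\<close>.\<close>

lemma no_consecutive_shortcuts:
  assumes "5 \<le> n" "(v i, v (i + 2)) \<in> R"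
  shows "(v (i + 2), v (i + 4)) \<notin> R"
proof
  assume "(v (i + 2), v (i + 4)) \<in> R"
  then have "(v i, v i) \<in> R ^^ Suc (Suc (i + n - (i + 4)))"
    by (intro relpow_Suc_I2[OF assms(2)] relpow_Suc_I2[OF _ walk_around]) (use assms in auto)
  moreover have "odd (Suc (Suc (i + n - (i + 4))))" "Suc (Suc (i + n - (i + 4))) < n"
    using assms(1) odd_length by auto
  ultimately show False using shortest by blast
qed

text \<open>The descent shared by the semicomplete and anti-quasi-transitive classes; the shorter
  chord may start anywhere, as only its length matters.\<close>

lemma shortcut_if_chord_shrinks:
  assumes chord: "(v i, v (i + k)) \<in> R" "even k" "2 \<le> k" "k + 3 \<le> n"
    and shrink: "\<And>i k. even k \<Longrightarrow> 4 \<le> k \<Longrightarrow> k + 3 \<le> n \<Longrightarrow> (v i, v (i + k)) \<in> R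
      \<Longrightarrow> \<exists>j. (v j, v (j + (k - 2))) \<in> R"
  obtains j where "(v j, v (j + 2)) \<in> R"
proof -
  have "\<exists>j. (v j, v (j + 2)) \<in> R"
    using chord
  proof (induction k arbitrary: i rule: less_induct)
    case (less k)
    show ?case
    proof (cases "k = 2")
      case False
      then have "4 \<le> k" using less.prems by presburger
      then obtain j where "(v j, v (j + (k - 2))) \<in> R" using shrink less.prems by blast
      then show ?thesis using less.IH[of "k - 2" j] less.prems \<open>4 \<le> k\<close> by auto
    qed (use less.prems in auto)
  qed
  then show ?thesis using that by blast
qed

section \<open>The adjacency conditions along a shortest odd closed walk\<close>

lemma quasi_transitive_length_3:
  assumes qt: "\<And>a b c d. distinct [a, b, c, d] \<Longrightarrow> (a, b) \<in> R \<Longrightarrow> (b, c) \<in> R \<Longrightarrow> (c, d) \<in> R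
    \<Longrightarrow> (a, d) \<in> R \<or> (d, a) \<in> R"
  shows "n = 3"
proof (rule ccontr)
  assume "n \<noteq> 3"
  then have "5 \<le> n" using length_ge_3 odd_length by presburger
  have back3: "(v (i + 3), v i) \<in> R" for i
  proof (rule backward_if_odd)
    show "(v i, v (i + 3)) \<in> R \<or> (v (i + 3), v i) \<in> R"
      using \<open>5 \<le> n\<close> step[of i] step[of "i + 1"] step[of "i + 2"]
      by (intro qt[of _ "v (i + 1)" "v (i + 2)"]) (auto simp: vertex_neq numeral_eq_Suc)
  qed (use \<open>5 \<le> n\<close> in auto)
  have far_back: "2 * k + 5 \<le> n \<Longrightarrow> (v (i + 2 * k + 3), v i) \<in> R" for i k
  proof (induction k)
    case (Suc k)
    let ?l = "i + 2 * k"
    show ?case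
    proof (rule backward_if_odd)
      \<comment> \<open>Jump back by 3, step forward by 1, then use the induction hypothesis: the
        backward jump grows by 2.\<close>
      have "(v (?l + 5), v i) \<in> R \<or> (v i, v (?l + 5)) \<in> R"
      proof (rule qt)
        show "(v (?l + 5), v (?l + 2)) \<in> R" using back3[of "?l + 2"] by (simp add: numeral_eq_Suc)
        show "(v (?l + 2), v (?l + 3)) \<in> R" using step[of "?l + 2"] by (simp add: numeral_eq_Suc)
        show "(v (?l + 3), v i) \<in> R" using Suc by simp
        show "distinct [v (?l + 5), v (?l + 2), v (?l + 3), v i]"
          using Suc.prems by (auto simp: vertex_neq)
      qed
      then show "(v i, v (i + 2 * Suc k + 3)) \<in> R \<or> (v (i + 2 * Suc k + 3), v i) \<in> R"
        by (auto simp: numeral_eq_Suc)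
    qed (use Suc.prems in auto)
  qed (use back3 in simp)
  define k where "k = (n - 5) div 2"
  have "n = 2 * k + 5" using \<open>5 \<le> n\<close> odd_length unfolding k_def by presburger
  \<comment> \<open>By periodicity the longest backward arc, from \<open>v l\<close> to
    \<open>v 0\<close>, is also a forward shortcut from \<open>v l\<close> to
    \<open>v (l + 2)\<close>.\<close>
  define l where "l = 2 * k + 3"
  have l: "l + 2 = n" using \<open>n = 2 * k + 5\<close> by (simp add: l_def)
  have "(v l, v 0) \<in> R" using far_back[of k 0] \<open>n = 2 * k + 5\<close> by (simp add: l_def)
  then have "(v l, v (l + 2)) \<in> R" using periodic[of 0] l by simp
  moreover have "(v (l + 2), v (l + 3)) \<in> R" using step[of "l + 2"] by (simp add: numeral_eq_Suc)
  ultimately have "(v l, v l) \<in> R ^^ 3"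
    using back3[of l] by (auto simp: numeral_eq_Suc intro: relcompI)
  then show False using shortest[of 3] \<open>5 \<le> n\<close> by auto
qed

lemma locally_in_semicomplete_chordless:
  assumes ls: "\<And>a b c d. distinct [a, b, c, d] \<Longrightarrow> (a, b) \<in> R \<Longrightarrow> (c, b) \<in> R \<Longrightarrow> (d, c) \<in> R
    \<Longrightarrow> (a, d) \<in> R \<or> (d, a) \<in> R"
    and k: "even k" "2 \<le> k" "k + 3 \<le> n"
  shows "(v i, v (i + k)) \<notin> R"
proof
  assume chord: "(v i, v (i + k)) \<in> R"
  \<comment> \<open>A shortcut moves one place backward: the condition applies to both shortcut ends
    and their predecessors.\<close>
  have shift: "(v j, v (j + 2)) \<in> R" if "(v (j + 1), v (j + 3)) \<in> R" for j
  proof (rule forward_if_even)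
    show "(v j, v (j + 2)) \<in> R \<or> (v (j + 2), v j) \<in> R"
      using that k step[of j] step[of "j + 2"]
        ls[of "v (j + 2)" "v (j + 3)" "v (j + 1)" "v j"] by (auto simp: vertex_neq numeral_eq_Suc)
  qed (use k in auto)
  obtain j where j: "(v j, v (j + 2)) \<in> R"
  proof (rule shortcut_if_chord_shrinks[OF chord k])
    fix i k assume *: "even k" "4 \<le> k" "k + 3 \<le> n" "(v i, v (i + k)) \<in> R"
    \<comment> \<open>The head of the chord moves back by two places; its tail stays.\<close>
    define l where "l = i + (k - 2)"
    have l: "i + k = l + 2" "even (i + l)" "i + 2 \<le> l" "l + 5 \<le> i + n" using * by (auto simp: l_def)
    have "(v i, v l) \<in> R"
    proof (rule forward_if_even)
      show "(v i, v l) \<in> R \<or> (v l, v i) \<in> R"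
        using * l step[of l] step[of "l + 1"] ls[of "v i" "v (l + 2)" "v (l + 1)" "v l"]
        by (auto simp: vertex_neq)
    qed (use l in auto)
    then show "\<exists>j. (v j, v (j + (k - 2))) \<in> R" by (auto simp: l_def)
  qed
  \<comment> \<open>Shifting goes backward and \<open>j\<close> may be below 2, so the index is
    first raised by a period.\<close>
  define l where "l = j + n - 2"
  have l: "l + 2 = j + n" using k by (simp add: l_def)
  have eq: "v (l + 2) = v j" "v (l + 4) = v (j + 2)"
    using periodic[of j] periodic[of "j + 2"] l by (auto simp: l_def add.commute add.left_commute)
  then have "(v (l + 2), v (l + 4)) \<in> R" using j by simp
  moreover from this have "(v l, v (l + 2)) \<in> R"
    using shift[of "l + 1"] shift[of l] by (simp add: numeral_eq_Suc)
  ultimately show False using no_consecutive_shortcuts[of l] k by simp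
qed

lemma locally_out_semicomplete_chordless:
  assumes ls: "\<And>a b c d. distinct [a, b, c, d] \<Longrightarrow> (b, a) \<in> R \<Longrightarrow> (c, b) \<in> R \<Longrightarrow> (c, d) \<in> R
    \<Longrightarrow> (a, d) \<in> R \<or> (d, a) \<in> R"
    and k: "even k" "2 \<le> k" "k + 3 \<le> n"
  shows "(v i, v (i + k)) \<notin> R"
proof
  assume chord: "(v i, v (i + k)) \<in> R"
  \<comment> \<open>Here a shortcut moves one place forward, to the successors of its ends.\<close>
  have shift: "(v (j + 1), v (j + 3)) \<in> R" if "(v j, v (j + 2)) \<in> R" for j
  proof (rule forward_if_even)
    show "(v (j + 1), v (j + 3)) \<in> R \<or> (v (j + 3), v (j + 1)) \<in> R"
      using that k step[of j] step[of "j + 2"]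
        ls[of "v (j + 3)" "v (j + 2)" "v j" "v (j + 1)"] by (auto simp: vertex_neq numeral_eq_Suc)
  qed (use k in auto)
  obtain j where j: "(v j, v (j + 2)) \<in> R"
  proof (rule shortcut_if_chord_shrinks[OF chord k])
    fix i k assume *: "even k" "4 \<le> k" "k + 3 \<le> n" "(v i, v (i + k)) \<in> R"
    \<comment> \<open>Now the tail of the chord advances by two places.\<close>
    have "(v (i + 2), v (i + k)) \<in> R"
    proof (rule forward_if_even)
      show "(v (i + 2), v (i + k)) \<in> R \<or> (v (i + k), v (i + 2)) \<in> R"
        using * step[of i] step[of "i + 1"] ls[of "v (i + 2)" "v (i + 1)" "v i" "v (i + k)"]
        by (auto simp: vertex_neq)
    qed (use * in auto)
    moreover have "i + 2 + (k - 2) = i + k" using * by simp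
    ultimately show "\<exists>j. (v j, v (j + (k - 2))) \<in> R" by (metis)
  qed
  have "(v (j + 2), v (j + 4)) \<in> R"
    using shift[OF j] shift[of "j + 1"] by (simp add: numeral_eq_Suc)
  then show False using j no_consecutive_shortcuts[of j] k by simp
qed

lemma anti_quasi_transitive_chordless:
  assumes aqt: "\<And>a b c d. distinct [a, b, c, d] \<Longrightarrow> (b, a) \<in> R \<Longrightarrow> (b, c) \<in> R \<Longrightarrow> (d, c) \<in> R
    \<Longrightarrow> (a, d) \<in> R \<or> (d, a) \<in> R"
    and no_tt3: "\<And>a b c. (a, b) \<in> R \<Longrightarrow> (b, c) \<in> R \<Longrightarrow> (a, c) \<notin> R"
    and k: "even k" "2 \<le> k" "k + 3 \<le> n"
  shows "(v i, v (i + k)) \<notin> R"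
proof
  assume chord: "(v i, v (i + k)) \<in> R"
  obtain j where "(v j, v (j + 2)) \<in> R"
  proof (rule shortcut_if_chord_shrinks[OF chord k])
    fix i k assume *: "even k" "4 \<le> k" "k + 3 \<le> n" "(v i, v (i + k)) \<in> R"
    \<comment> \<open>Both ends of the chord move inward by one place, to \<open>v (i + 1)\<close>
      and \<open>v l\<close>.\<close>
    define l where "l = i + (k - 1)"
    have l: "i + k = l + 1" "odd (i + l)" "i + 3 \<le> l" "l + 4 \<le> i + n" using * by (auto simp: l_def)
    have "(v (i + 1), v l) \<in> R"
    proof (rule forward_if_even)
      show "(v (i + 1), v l) \<in> R \<or> (v l, v (i + 1)) \<in> R"
        using * l step[of i] step[of l] aqt[of "v (i + 1)" "v i" "v (l + 1)" "v l"]
        by (auto simp: vertex_neq)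
    qed (use l in auto)
    moreover have "i + 1 + (k - 2) = l" using * by (simp add: l_def)
    ultimately show "\<exists>j. (v j, v (j + (k - 2))) \<in> R" by metis
  qed
  then show False using no_tt3[of "v j" "v (j + 1)" "v (j + 2)"] step[of j] step[of "j + 1"]
    by simp
qed

end

section \<open>Induced odd cycles and the characterisations\<close>

lemma (in digraph) has_induced_cycle_if_chordless:
  assumes "shortest_odd_closed_walk (arcs_ends G) n v"
    and "\<And>i k. even k \<Longrightarrow> 2 \<le> k \<Longrightarrow> k + 3 \<le> n \<Longrightarrow> \<not> v i \<rightarrow>\<^bsub>G\<^esub> v (i + k)"
  shows "has_induced_copy G (with_proj (directed_cycle n))"
proof (rule has_induced_copy_with_projI[OF pair_wf_digraph_directed_cycle])
  interpret shortest_odd_closed_walk "arcs_ends G" n v by fact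
  show "inj_on v (pverts (directed_cycle n))"
  proof (rule linorder_inj_onI')
    fix i j assume "i \<in> pverts (directed_cycle n)" "j \<in> pverts (directed_cycle n)" "i < j"
    then show "v i \<noteq> v j" by (intro vertex_neq) (auto simp: directed_cycle_def)
  qed
  show "v ` pverts (directed_cycle n) \<subseteq> verts G"
    using step by (auto dest: adj_in_verts)
  show "v i \<rightarrow>\<^bsub>G\<^esub> v j \<longleftrightarrow> (i, j) \<in> parcs (directed_cycle n)"
    if "i \<in> pverts (directed_cycle n)" "j \<in> pverts (directed_cycle n)" for i j
    using that forward_chord_iff_if_chordless[OF assms(2)] by (auto simp: directed_cycle_def)
qed

theorem theorem12:
  fixes D :: "('a,'b) pre_digraph"
  assumes "digraph D" and "asymmetric D"
  shows "(three_quasi_transitive D \<longrightarrow>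
            (KP_digraph D \<longleftrightarrow> \<not> has_induced_copy D (with_proj (directed_cycle 3)))) \<and>
         (arc_locally_in_semicomplete D \<or> arc_locally_out_semicomplete D \<or>
            (three_anti_quasi_transitive D \<and> TT3_free D) \<longrightarrow>
            (KP_digraph D \<longleftrightarrow>
               \<not> (\<exists>n\<ge>2. odd n \<and> has_induced_copy D (with_proj (directed_cycle n)))))"
proof -
  interpret digraph D by fact
  have asym: "\<not> y \<rightarrow>\<^bsub>D\<^esub> x" if "x \<rightarrow>\<^bsub>D\<^esub> y" for x y
    using \<open>asymmetric D\<close> that by (auto simp: asymmetric_def)
  have KP: "KP_digraph D" if "\<And>n v. shortest_odd_closed_walk (arcs_ends D) n v \<Longrightarrow> False"
    using that asym shortest_odd_closed_walk_exists[of "arcs_ends D"]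
    by (intro KP_digraph_if_no_odd_closed_walk) metis
  show ?thesis
  proof (intro conjI impI)
    assume qt: "three_quasi_transitive D"
    have "KP_digraph D" if no_C3: "\<not> has_induced_copy D (with_proj (directed_cycle 3))"
    proof (rule KP)
      fix n v assume cycle: "shortest_odd_closed_walk (arcs_ends D) n v"
      then interpret shortest_odd_closed_walk "arcs_ends D" n v .
      have "n = 3" using qt
        by (intro quasi_transitive_length_3) (auto simp: three_quasi_transitive_def adjacent_def)
      \<comment> \<open>For \<open>n = 3\<close> no \<open>k\<close> satisfies
        \<open>2 \<le> k\<close> and \<open>k + 3 \<le> n\<close>, so the walk is chordless.\<close>
      then show False using has_induced_cycle_if_chordless[OF cycle] no_C3 by simp
    qed
    then show "KP_digraph D \<longleftrightarrow> \<not> has_induced_copy D (with_proj (directed_cycle 3))"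
      using not_KP_digraph_if_odd_cycle[of D 3] by auto
  next
    assume classes: "arc_locally_in_semicomplete D \<or> arc_locally_out_semicomplete D \<or>
      (three_anti_quasi_transitive D \<and> TT3_free D)"
    let ?odd_cycle = "\<exists>n\<ge>2. odd n \<and> has_induced_copy D (with_proj (directed_cycle n))"
    have "KP_digraph D" if no_odd_cycle: "\<not> ?odd_cycle"
    proof (rule KP)
      fix n v assume cycle: "shortest_odd_closed_walk (arcs_ends D) n v"
      then interpret shortest_odd_closed_walk "arcs_ends D" n v .
      have "\<not> v i \<rightarrow>\<^bsub>D\<^esub> v (i + k)" if k: "even k" "2 \<le> k" "k + 3 \<le> n" for i k
        using classes
      proof (elim disjE conjE)
        assume "arc_locally_in_semicomplete D"
        then show ?thesis using k by (intro locally_in_semicomplete_chordless)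
            (auto simp: arc_locally_in_semicomplete_def adjacent_def)
      next
        assume "arc_locally_out_semicomplete D"
        then show ?thesis using k by (intro locally_out_semicomplete_chordless)
            (auto simp: arc_locally_out_semicomplete_def adjacent_def)
      next
        assume "three_anti_quasi_transitive D" "TT3_free D"
        then show ?thesis
          using k no_transitive_triple_if_TT3_free[OF \<open>asymmetric D\<close>]
          by (intro anti_quasi_transitive_chordless)
            (auto simp: three_anti_quasi_transitive_def adjacent_def)
      qed
      then have "has_induced_copy D (with_proj (directed_cycle n))"
        by (rule has_induced_cycle_if_chordless[OF cycle])
      moreover have "2 \<le> n" using length_ge_3 by simp
      ultimately show False using no_odd_cycle odd_length by blast
    qed
    then show "KP_digraph D \<longleftrightarrow> \<not> ?odd_cycle"
      using not_KP_digraph_if_odd_cycle[of D] by blast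
  qed
qed

end
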